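(* Let $G$ be a finite graph. Then the set of friendly separations of $G$ is a nested set of separations; and hence it gives rise to a tree-decomposition of $G$ that efficiently distinguishes every pair of distinguishable tangles in $G$.
   Context: A separation of a graph $G$ is a set $\{A,B\}$ with $A\cup B=V(G)$ such that $G$ has no edge between $A\setminus B$ and $B\setminus A$; its sides are $A,B$, its separator is $A\cap B$, and its order is $|A\cap B|$. It is proper if $A\setminus B$ and $B\setminus A$ are both non-empty. Two separations $\{A,B\},\{C,D\}$ are nested if, after possibly renaming their sides, $A\subseteq C$ and $B\supseteq D$; otherwise they cross. A set of separations is nested if its elements are pairwise nested. If $\{A,B\}$ and $\{C,D\}$ cross, their four corners are $\{A\cap C,B\cup D\}$, $\{A\cap D,B\cup C\}$, $\{B\cap D,A\cup C\}$, $\{B\cap C,A\cup D\}$; the corners $\{A\cap C,B\cup D\}$ and $\{A\cap D,B\cup C\}$ lie on the same side of $\{A,B\}$, and so do $\{B\cap D,A\cup C\}$ and $\{B\cap C,A\cup D\}$ (analogously for sides of $\{C,D\}$). An entanglement in $G$ is a non-empty set $\varepsilon$ of proper separations of $G$ such that: if a separation $\{A,B\}\in\varepsilon$ is crossed by a separation of $G$ so that two corners lying on the same side of $\{A,B\}$ both have order at most $|A\cap B|$, then at least one of these two corners has order equal to $|A\cap B|$ and is contained in $\varepsilon$. A separation $s$ is friendly if it lies in some entanglement $\varepsilon$ in $G$ such that no other separation in $\varepsilon$ crosses fewer separations (counted among all separations that lie in at least one entanglement in $G$) than $s$ does. Tangles: an oriented separation is an ordered pair $(A,B)$ with $\{A,B\}$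 a separation. A tangle of order $k$ in $G$ is a set $\tau$ of oriented separations of order $<k$ containing exactly one of $(A,B),(B,A)$ for every separation $\{A,B\}$ of order $<k$, such that there are no $(A_1,B_1),(A_2,B_2),(A_3,B_3)\in\tau$ (not necessarily distinct) with $G[A_1]\cup G[A_2]\cup G[A_3]=G$. A separation $\{A,B\}$ distinguishes tangles $\tau,\tau'$ if $(A,B)\in\tau$ and $(B,A)\in\tau'$ or vice versa; it does so efficiently if its order is minimum among all separations of $G$ distinguishing $\tau$ and $\tau'$. Two tangles are distinguishable if some separation distinguishes them. A tree-decomposition $(T,(V_t)_{t\in T})$ of $G$ induces for each edge $t_1t_2$ of $T$ the separation $\{\bigcup_{t\in T_1}V_t,\bigcup_{t\in T_2}V_t\}$, where $T_1,T_2$ are the components of $T-t_1t_2$; it efficiently distinguishes a pair of tangles if some separation induced by an edge efficiently distinguishes them. *)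

theory Defs
  imports Main
begin

record 'v graph =
  verts :: "'v set"
  edges :: "'v set set"

definition simple_graph :: "'v graph \<Rightarrow> bool" where
  "simple_graph G \<longleftrightarrow>
     (\<forall>e\<in>edges G. \<exists>u v. u \<in> verts G \<and> v \<in> verts G \<and> u \<noteq> v \<and> e = {u, v})"

definition finite_graph :: "'v graph \<Rightarrow> bool" where
  "finite_graph G \<longleftrightarrow> simple_graph G \<and> finite (verts G)"

definition induced_subgraph :: "'v graph \<Rightarrow> 'v set \<Rightarrow> 'v graph" where
  "induced_subgraph G X = \<lparr>verts = verts G \<inter> X, edges = {e \<in> edges G. e \<subseteq> X}\<rparr>"

definition graph_union :: "'v graph \<Rightarrow> 'v graph \<Rightarrow> 'v graph" where
  "graph_union G H = \<lparr>verts = verts G \<union> verts H, edges = edges G \<union> edges H\<rparr>"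

definition delete_edge :: "'v graph \<Rightarrow> 'v set \<Rightarrow> 'v graph" where
  "delete_edge G e = \<lparr>verts = verts G, edges = edges G - {e}\<rparr>"

definition component_of :: "'v graph \<Rightarrow> 'v \<Rightarrow> 'v set" where
  "component_of G v = {w \<in> verts G. (v, w) \<in> {(x, y). {x, y} \<in> edges G}\<^sup>*}"

definition connected_graph :: "'v graph \<Rightarrow> bool" where
  "connected_graph G \<longleftrightarrow> verts G \<noteq> {} \<and> (\<forall>v\<in>verts G. component_of G v = verts G)"

text \<open>A cycle is given by the list of its vertices in cyclic order.\<close>

definition is_cycle :: "'v graph \<Rightarrow> 'v list \<Rightarrow> bool" where
  "is_cycle G p \<longleftrightarrow> length p \<ge> 3 \<and> distinct p \<and>
     (\<forall>i<length p. {p ! i, p ! (Suc i mod length p)} \<in> edges G)"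

definition is_tree :: "'v graph \<Rightarrow> bool" where
  "is_tree T \<longleftrightarrow> simple_graph T \<and> connected_graph T \<and> \<not> (\<exists>p. is_cycle T p)"

text \<open>
  An oriented separation is a pair of sides; an (unoriented) separation is the set of its two
  sides. Predicates on unoriented separations quantify over all ways of writing the set
  as \<open>{A, B}\<close>, which is how renaming of sides is rendered.
\<close>

definition oriented_separation :: "'v graph \<Rightarrow> 'v set \<times> 'v set \<Rightarrow> bool" where
  "oriented_separation G = (\<lambda>(A, B). A \<union> B = verts G \<and>
     \<not> (\<exists>u\<in>A - B. \<exists>v\<in>B - A. {u, v} \<in> edges G))"

definition separation :: "'v graph \<Rightarrow> 'v set set \<Rightarrow> bool" where
  "separation G s \<longleftrightarrow> (\<exists>A B. s = {A, B} \<and> oriented_separation G (A, B))"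

definition separator :: "'v set set \<Rightarrow> 'v set" where
  "separator s = \<Inter> s"

definition sep_order :: "'v set set \<Rightarrow> nat" where
  "sep_order s = card (separator s)"

definition proper_separation :: "'v graph \<Rightarrow> 'v set set \<Rightarrow> bool" where
  "proper_separation G s \<longleftrightarrow> separation G s \<and>
     (\<exists>A B. s = {A, B} \<and> A - B \<noteq> {} \<and> B - A \<noteq> {})"

definition nested :: "'v set set \<Rightarrow> 'v set set \<Rightarrow> bool" where
  "nested s t \<longleftrightarrow> (\<exists>A B C D. s = {A, B} \<and> t = {C, D} \<and> A \<subseteq> C \<and> D \<subseteq> B)"

abbreviation crosses :: "'v set set \<Rightarrow> 'v set set \<Rightarrow> bool" where
  "crosses s t \<equiv> \<not> nested s t"

definition nested_separations :: "'v graph \<Rightarrow> 'v set set set \<Rightarrow> bool" where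
  "nested_separations G S \<longleftrightarrow> (\<forall>s\<in>S. separation G s) \<and> (\<forall>s\<in>S. \<forall>t\<in>S. nested s t)"

text \<open>
  The two corners named below lie on the side \<open>A\<close> of \<open>{A, B}\<close>; since \<open>A\<close> and \<open>B\<close> may be
  interchanged, the condition also covers the two corners on the side \<open>B\<close>.
\<close>

definition entanglement :: "'v graph \<Rightarrow> 'v set set set \<Rightarrow> bool" where
  "entanglement G \<epsilon> \<longleftrightarrow> \<epsilon> \<noteq> {} \<and> (\<forall>s\<in>\<epsilon>. proper_separation G s) \<and>
     (\<forall>A B C D. {A, B} \<in> \<epsilon> \<longrightarrow> separation G {C, D} \<longrightarrow> crosses {A, B} {C, D} \<longrightarrow>
        sep_order {A \<inter> C, B \<union> D} \<le> sep_order {A, B} \<longrightarrow>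
        sep_order {A \<inter> D, B \<union> C} \<le> sep_order {A, B} \<longrightarrow>
        (sep_order {A \<inter> C, B \<union> D} = sep_order {A, B} \<and> {A \<inter> C, B \<union> D} \<in> \<epsilon>) \<or>
        (sep_order {A \<inter> D, B \<union> C} = sep_order {A, B} \<and> {A \<inter> D, B \<union> C} \<in> \<epsilon>))"

definition entangled_separations :: "'v graph \<Rightarrow> 'v set set set" where
  "entangled_separations G = \<Union> {\<epsilon>. entanglement G \<epsilon>}"

definition crossing_number :: "'v graph \<Rightarrow> 'v set set \<Rightarrow> nat" where
  "crossing_number G s = card {t \<in> entangled_separations G. crosses s t}"

definition friendly :: "'v graph \<Rightarrow> 'v set set \<Rightarrow> bool" where
  "friendly G s \<longleftrightarrow> (\<exists>\<epsilon>. entanglement G \<epsilon> \<and> s \<in> \<epsilon> \<and>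
     \<not> (\<exists>t\<in>\<epsilon>. crossing_number G t < crossing_number G s))"

definition friendly_separations :: "'v graph \<Rightarrow> 'v set set set" where
  "friendly_separations G = {s. friendly G s}"

definition tangle :: "'v graph \<Rightarrow> nat \<Rightarrow> ('v set \<times> 'v set) set \<Rightarrow> bool" where
  "tangle G k \<tau> \<longleftrightarrow>
     (\<forall>(A, B)\<in>\<tau>. oriented_separation G (A, B) \<and> card (A \<inter> B) < k) \<and>
     (\<forall>A B. oriented_separation G (A, B) \<and> card (A \<inter> B) < k \<longrightarrow>
        (\<exists>!p. p \<in> {(A, B), (B, A)} \<and> p \<in> \<tau>)) \<and>
     \<not> (\<exists>(A1, B1)\<in>\<tau>. \<exists>(A2, B2)\<in>\<tau>. \<exists>(A3, B3)\<in>\<tau>.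
          graph_union (graph_union (induced_subgraph G A1) (induced_subgraph G A2))
            (induced_subgraph G A3) = G)"

definition distinguishes ::
    "'v set set \<Rightarrow> ('v set \<times> 'v set) set \<Rightarrow> ('v set \<times> 'v set) set \<Rightarrow> bool" where
  "distinguishes s \<tau> \<tau>' \<longleftrightarrow> (\<exists>A B. s = {A, B} \<and> (A, B) \<in> \<tau> \<and> (B, A) \<in> \<tau>')"

definition distinguishable ::
    "'v graph \<Rightarrow> ('v set \<times> 'v set) set \<Rightarrow> ('v set \<times> 'v set) set \<Rightarrow> bool" where
  "distinguishable G \<tau> \<tau>' \<longleftrightarrow> (\<exists>s. separation G s \<and> distinguishes s \<tau> \<tau>')"

definition efficiently_distinguishes ::
    "'v graph \<Rightarrow> 'v set set \<Rightarrow> ('v set \<times> 'v set) set \<Rightarrow> ('v set \<times> 'v set) set \<Rightarrow> bool" where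
  "efficiently_distinguishes G s \<tau> \<tau>' \<longleftrightarrow> separation G s \<and> distinguishes s \<tau> \<tau>' \<and>
     (\<forall>s'. separation G s' \<and> distinguishes s' \<tau> \<tau>' \<longrightarrow> sep_order s \<le> sep_order s')"

definition tree_decomposition :: "'v graph \<Rightarrow> 't graph \<Rightarrow> ('t \<Rightarrow> 'v set) \<Rightarrow> bool" where
  "tree_decomposition G T V \<longleftrightarrow> is_tree T \<and>
     (\<Union>t\<in>verts T. V t) = verts G \<and>
     (\<forall>e\<in>edges G. \<exists>t\<in>verts T. e \<subseteq> V t) \<and>
     (\<forall>v\<in>verts G. connected_graph (induced_subgraph T {t. v \<in> V t}))"

text \<open>
  The separation induced by the edge \<open>e\<close> of \<open>T\<close>: each end \<open>t\<close> of \<open>e\<close> contributes the union of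
  the parts at the nodes in the component of \<open>T - e\<close> that contains \<open>t\<close>.
\<close>

definition induced_separation :: "'t graph \<Rightarrow> ('t \<Rightarrow> 'v set) \<Rightarrow> 't set \<Rightarrow> 'v set set" where
  "induced_separation T V e = (\<lambda>t. \<Union>x\<in>component_of (delete_edge T e) t. V x) ` e"

definition td_efficiently_distinguishes ::
    "'v graph \<Rightarrow> 't graph \<Rightarrow> ('t \<Rightarrow> 'v set) \<Rightarrow>
     ('v set \<times> 'v set) set \<Rightarrow> ('v set \<times> 'v set) set \<Rightarrow> bool" where
  "td_efficiently_distinguishes G T V \<tau> \<tau>' \<longleftrightarrow>
     (\<exists>e\<in>edges T. efficiently_distinguishes G (induced_separation T V e) \<tau> \<tau>')"

text \<open>
  A set of separations gives rise to a tree-decomposition if its elements are precisely the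
  separations induced by the edges of the tree, each induced by exactly one edge.
\<close>

definition gives_rise_to :: "'v set set set \<Rightarrow> 't graph \<Rightarrow> ('t \<Rightarrow> 'v set) \<Rightarrow> bool" where
  "gives_rise_to S T V \<longleftrightarrow> bij_betw (induced_separation T V) (edges T) S"

end

theory Submission
  imports Defs
begin

text \<open>
  Suppose two friendly separations \<open>s\<close>, \<open>t\<close> cross. Opposite corners together cross strictly fewer
  entangled separations than \<open>s\<close> and \<open>t\<close> do, while their orders add up to those of \<open>s\<close> and \<open>t\<close>;
  playing the two entanglements against each other contradicts the minimality of the crossing
  numbers. The separations efficiently distinguishing two given tangles form an entanglement,
  hence one of them is friendly. A finite nested set of separations yields a tree-decomposition
  by induction: a minimal oriented separation \<open>(A, B)\<close> becomes a new leaf with part \<open>A\<close>, attached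
  to the node whose part contains \<open>A\<close>.
\<close>

section \<open>Nested separations and corners\<close>

lemma nested_iff:
  "nested {A, B} {C, D} \<longleftrightarrow>
     (A \<subseteq> C \<and> D \<subseteq> B) \<or> (A \<subseteq> D \<and> C \<subseteq> B) \<or> (C \<subseteq> A \<and> B \<subseteq> D) \<or> (D \<subseteq> A \<and> B \<subseteq> C)"
  (is "?L \<longleftrightarrow> ?R")
proof
  assume ?L
  then show ?R
    unfolding nested_def doubleton_eq_iff by (elim exE conjE disjE) simp_all
next
  assume ?R
  then show ?L
    unfolding nested_def doubleton_eq_iff by (elim disjE) blast+
qed

lemma nested_sym: "nested s t \<Longrightarrow> nested t s"
  unfolding nested_def by (metis insert_commute)

lemma nested_corner_self: "nested {A, B} {A \<inter> C, B \<union> D}"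
  unfolding nested_iff by blast

text \<open>If \<open>A\<close> or \<open>C\<close> lies inside a side of \<open>{E, F}\<close>, so
  does the corner. Otherwise \<open>A\<close> and \<open>C\<close> each contain a side: the same
  side gives the claim, while different ones, say \<open>E \<subseteq> A\<close> and
  \<open>F \<subseteq> C\<close>, yield \<open>B \<subseteq> F \<subseteq> C\<close> and
  \<open>D \<subseteq> E \<subseteq> A\<close>, against crossing.\<close>

lemma nested_corner:
  assumes "crosses {A, B} {C, D}" "nested {A, B} {E, F}" "nested {C, D} {E, F}"
  shows "nested {A \<inter> C, B \<union> D} {E, F}"
proof -
  have "\<not> (D \<subseteq> A \<and> B \<subseteq> C)" "\<not> (C \<subseteq> A \<and> B \<subseteq> D)" "\<not> (A \<subseteq> C \<and> D \<subseteq> B)" "\<not> (A \<subseteq> D \<and> C \<subseteq> B)"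
    using assms(1) unfolding nested_iff by simp_all
  with assms(2,3) show ?thesis
    unfolding nested_iff
    by (elim disjE conjE)
      (simp_all add: le_infI1 le_infI2 le_supI1 le_supI2, (meson order_trans)+)
qed

text \<open>One of \<open>A\<close>, \<open>B\<close> lies inside a side of \<open>{E, F}\<close>
  and the other contains the opposite side; shrinking the first and enlarging the second, as one of
  the two corners does, keeps both inclusions.\<close>

lemma nested_opposite_corner:
  assumes "nested {A, B} {E, F}"
  shows "nested {A \<inter> C, B \<union> D} {E, F} \<or> nested {B \<inter> D, A \<union> C} {E, F}"
  using assms unfolding nested_iff by (elim disjE conjE) (simp_all add: le_infI1 le_infI2 le_supI1 le_supI2)

section \<open>Separations, their corners and orders\<close>

lemma oriented_separation_swap: "oriented_separation G (A, B) \<Longrightarrow> oriented_separation G (B, A)"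
  unfolding oriented_separation_def prod.case using insert_commute by (metis Un_commute)

lemma separation_iff: "separation G {A, B} \<longleftrightarrow> oriented_separation G (A, B)"
  unfolding separation_def doubleton_eq_iff using oriented_separation_swap by blast

lemma oriented_separation_edge:
  assumes "oriented_separation G (A, B)" "{u, v} \<in> edges G" "u \<in> verts G" "v \<in> verts G"
  shows "{u, v} \<subseteq> A \<or> {u, v} \<subseteq> B"
proof (rule ccontr)
  assume "\<not> ?thesis"
  then have "(u \<in> A - B \<and> v \<in> B - A) \<or> (v \<in> A - B \<and> u \<in> B - A)"
    using assms(1,3,4) unfolding oriented_separation_def by auto
  moreover have "{v, u} \<in> edges G"
    using assms(2) insert_commute[of v u "{}"] by simp
  ultimately show False
    using assms(1,2) unfolding oriented_separation_def by auto
qed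

lemma oriented_separation_corner:
  assumes "oriented_separation G (A, B)" "oriented_separation G (C, D)"
  shows "oriented_separation G (A \<inter> C, B \<union> D)"
proof -
  have "{u, v} \<notin> edges G" if "u \<in> A \<inter> C - (B \<union> D)" "v \<in> (B \<union> D) - A \<inter> C" for u v
    using that assms unfolding oriented_separation_def by blast
  then show ?thesis
    using assms unfolding oriented_separation_def by blast
qed

lemma sep_order_doubleton [simp]: "sep_order {A, B} = card (A \<inter> B)"
  by (simp add: sep_order_def separator_def)

text \<open>The two corner separators have the same union and the same intersection as the two
  original separators. So if one corner exceeds one of the orders, the opposite corner falls below
  the other.\<close>

lemma opposite_corner_orders:
  assumes "finite V" "A \<union> B = V" "C \<union> D = V"
  shows "card (A \<inter> C \<inter> (B \<union> D)) + card (B \<inter> D \<inter> (A \<union> C)) = card (A \<inter> B) + card (C \<inter> D)"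
proof -
  let ?P = "A \<inter> C \<inter> (B \<union> D)" and ?R = "B \<inter> D \<inter> (A \<union> C)"
  have fin: "finite A" "finite B" "finite C" "finite D"
    using assms by (metis finite_Un)+
  have "?P \<union> ?R = A \<inter> B \<union> C \<inter> D" and "?P \<inter> ?R = A \<inter> B \<inter> (C \<inter> D)"
    using assms by blast+
  then show ?thesis
    using card_Un_Int[of ?P ?R] card_Un_Int[of "A \<inter> B" "C \<inter> D"] fin by simp
qed

section \<open>Finiteness and crossing numbers\<close>

lemma finite_separations:
  assumes "finite (verts G)"
  shows "finite {s. separation G s}"
proof (rule finite_subset)
  show "{s. separation G s} \<subseteq> Pow (Pow (verts G))"
    by (auto simp: separation_def oriented_separation_def)
qed (use assms in simp)

lemma entanglement_separation: "entanglement G \<epsilon> \<Longrightarrow> s \<in> \<epsilon> \<Longrightarrow> separation G s"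
  unfolding entanglement_def proper_separation_def by blast

lemma finite_entangled_separations:
  assumes "finite (verts G)"
  shows "finite (entangled_separations G)"
  by (rule finite_subset[OF _ finite_separations[OF assms]])
    (auto simp: entangled_separations_def dest: entanglement_separation)

text \<open>A separation nested with both \<open>{A, B}\<close> and \<open>{C, D}\<close> is nested
  with both corners, and one nested with at least one of them is nested with at least one corner.
  Hence neither the union nor the intersection of the sets of crossing separations grows, and
  inclusion-exclusion compares the sums.\<close>

lemma crossing_number_opposite_corners:
  assumes fin: "finite (verts G)"
    and mem: "{A, B} \<in> entangled_separations G" "{C, D} \<in> entangled_separations G"
    and cross: "crosses {A, B} {C, D}"
  shows "crossing_number G {A \<inter> C, B \<union> D} + crossing_number G {B \<inter> D, A \<union> C}
    < crossing_number G {A, B} + crossing_number G {C, D}"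
proof -
  let ?X = "\<lambda>s. {t \<in> entangled_separations G. crosses s t}"
  let ?c = "{A \<inter> C, B \<union> D}" and ?d = "{B \<inter> D, A \<union> C}"
  have finX: "finite (?X s)" for s
    using finite_entangled_separations[OF fin] by simp
  have doubleton: "\<exists>E F. t = {E, F}" if "t \<in> entangled_separations G" for t
  proof -
    have "separation G t"
      using that entanglement_separation unfolding entangled_separations_def by blast
    then show ?thesis
      unfolding separation_def by (elim exE conjE) (intro exI)
  qed
  have swap: "{A, B} = {B, A}" "{C, D} = {D, C}"
    by blast+
  have "nested ?c t \<and> nested ?d t"
    if t: "t \<in> entangled_separations G" "nested {A, B} t" "nested {C, D} t" for t
  proof -
    obtain E F where EF: "t = {E, F}"
      using doubleton[OF t(1)] by blast
    show ?thesis
      using t(2,3) cross nested_corner[of A B C D E F] nested_corner[of B A D C E F]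
      unfolding EF swap[symmetric] by blast
  qed
  moreover have "nested {A, B} ?c" "nested {A, B} ?d"
    using nested_corner_self[of A B C D] nested_corner_self[of B A D C]
    unfolding swap[symmetric] by blast+
  \<comment> \<open>Strictness: \<open>{A, B}\<close> crosses \<open>{C, D}\<close> but is nested
    with both corners, so it drops out of the union.\<close>
  ultimately have "?X ?c \<union> ?X ?d \<subseteq> ?X {A, B} \<union> ?X {C, D} - {{A, B}}"
    using nested_sym by blast
  moreover have "{A, B} \<in> ?X {C, D}"
    using mem cross nested_sym by blast
  ultimately have "?X ?c \<union> ?X ?d \<subset> ?X {A, B} \<union> ?X {C, D}"
    by blast
  then have un: "card (?X ?c \<union> ?X ?d) < card (?X {A, B} \<union> ?X {C, D})"
    by (intro psubset_card_mono) (simp_all only: finX finite_Un)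
  have "nested ?c t \<or> nested ?d t"
    if t: "t \<in> entangled_separations G" "nested {A, B} t \<or> nested {C, D} t" for t
  proof -
    obtain E F where EF: "t = {E, F}"
      using doubleton[OF t(1)] by blast
    show ?thesis
      using t(2) nested_opposite_corner[of A B E F C D] nested_opposite_corner[of C D E F A B]
      unfolding EF by (simp only: ac_simps) blast
  qed
  then have "?X ?c \<inter> ?X ?d \<subseteq> ?X {A, B} \<inter> ?X {C, D}"
    by blast
  then have "card (?X ?c \<inter> ?X ?d) \<le> card (?X {A, B} \<inter> ?X {C, D})"
    by (rule card_mono[OF finite_Int[OF disjI1[OF finX]]])
  with un card_Un_Int[OF finX finX, of ?c ?d] card_Un_Int[OF finX finX, of "{A, B}" "{C, D}"]
  show ?thesis
    unfolding crossing_number_def by linarith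
qed

section \<open>Friendly separations\<close>

lemma entanglement_corners:
  assumes "entanglement G \<epsilon>" "{A, B} \<in> \<epsilon>" "separation G {C, D}" "crosses {A, B} {C, D}"
    and "card (A \<inter> C \<inter> (B \<union> D)) \<le> card (A \<inter> B)"
    and "card (A \<inter> D \<inter> (B \<union> C)) \<le> card (A \<inter> B)"
  shows "(card (A \<inter> C \<inter> (B \<union> D)) = card (A \<inter> B) \<and> {A \<inter> C, B \<union> D} \<in> \<epsilon>) \<or>
    (card (A \<inter> D \<inter> (B \<union> C)) = card (A \<inter> B) \<and> {A \<inter> D, B \<union> C} \<in> \<epsilon>)"
  using assms unfolding entanglement_def sep_order_doubleton by blast

text \<open>Each of the four sides of \<open>s\<close> and \<open>t\<close> supplies an alternative:
  a corner there is too large, or one has exactly the order of its separation and, lying in the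
  entanglement, crosses at least as many separations. Opposite corners have a fixed order sum and a
  strictly smaller crossing sum, which is incompatible with these alternatives.\<close>

lemma friendly_nested:
  assumes fin: "finite (verts G)" and "friendly G s" "friendly G t"
  shows "nested s t"
proof (rule ccontr)
  assume cross: "crosses s t"
  obtain \<epsilon> where \<epsilon>: "entanglement G \<epsilon>" "s \<in> \<epsilon>"
    "\<And>c. c \<in> \<epsilon> \<Longrightarrow> crossing_number G s \<le> crossing_number G c"
    using assms(2) unfolding friendly_def by (meson not_less)
  obtain \<delta> where \<delta>: "entanglement G \<delta>" "t \<in> \<delta>"
    "\<And>c. c \<in> \<delta> \<Longrightarrow> crossing_number G t \<le> crossing_number G c"
    using assms(3) unfolding friendly_def by (meson not_less)
  have sep: "separation G s" "separation G t"
    using \<epsilon> \<delta> entanglement_separation by blast+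
  then obtain A B C D where s: "s = {A, B}" and t: "t = {C, D}"
    and AB: "A \<union> B = verts G" and CD: "C \<union> D = verts G"
    unfolding separation_def oriented_separation_def by auto
  have s': "s = {B, A}" and t': "t = {D, C}"
    using s t by auto
  have ent: "s \<in> entangled_separations G" "t \<in> entangled_separations G"
    using \<epsilon> \<delta> unfolding entangled_separations_def by blast+
  have cross': "crosses t s"
    using cross nested_sym by blast
  let ?ac = "{A \<inter> C, B \<union> D}" and ?ad = "{A \<inter> D, B \<union> C}"
  let ?bd = "{B \<inter> D, A \<union> C}" and ?bc = "{B \<inter> C, A \<union> D}"
  let ?x = "crossing_number G"
  define ac ad bd bc where defs: "ac = card (A \<inter> C \<inter> (B \<union> D))" "ad = card (A \<inter> D \<inter> (B \<union> C))"
    "bd = card (B \<inter> D \<inter> (A \<union> C))" "bc = card (B \<inter> C \<inter> (A \<union> D))"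
  define m n where mn: "m = card (A \<inter> B)" "n = card (C \<inter> D)"
  have sums: "ac + bd = m + n" "ad + bc = m + n"
    using opposite_corner_orders[OF fin AB CD] opposite_corner_orders[OF fin AB, of D C] CD
    unfolding defs mn by (simp_all add: Un_commute Int_commute)
  have x: "?x ?ac + ?x ?bd < ?x s + ?x t" "?x ?ad + ?x ?bc < ?x s + ?x t"
    using crossing_number_opposite_corners[OF fin, of A B C D]
      crossing_number_opposite_corners[OF fin, of A B D C] ent cross
    unfolding s t by (simp_all add: insert_commute)
  \<comment> \<open>The facts \<open>A\<close> to \<open>D\<close> come from the sides with these
    names; the first two use the entanglement of \<open>s\<close>, the others that of
    \<open>t\<close>.\<close>
  have A: "m < ac \<or> m < ad \<or> ac = m \<and> ?x s \<le> ?x ?ac \<or> ad = m \<and> ?x s \<le> ?x ?ad"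
    using entanglement_corners[of G \<epsilon> A B C D] \<epsilon> sep cross
    unfolding s t defs mn not_le[symmetric] by blast
  have B: "m < bc \<or> m < bd \<or> bc = m \<and> ?x s \<le> ?x ?bc \<or> bd = m \<and> ?x s \<le> ?x ?bd"
    using entanglement_corners[of G \<epsilon> B A C D] \<epsilon> sep cross
    unfolding s' t defs mn Int_commute[of A B] not_le[symmetric] by blast
  have C: "n < ac \<or> n < bc \<or> ac = n \<and> ?x t \<le> ?x ?ac \<or> bc = n \<and> ?x t \<le> ?x ?bc"
    using entanglement_corners[of G \<delta> C D A B] \<delta> sep cross'
    unfolding s t defs mn Int_commute[of C A] Int_commute[of C B] Un_commute[of D A]
      Un_commute[of D B] not_le[symmetric] by blast
  have D: "n < ad \<or> n < bd \<or> ad = n \<and> ?x t \<le> ?x ?ad \<or> bd = n \<and> ?x t \<le> ?x ?bd"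
    using entanglement_corners[of G \<delta> D C A B] \<delta> sep cross'
    unfolding s t' defs mn Int_commute[of D A] Int_commute[of D B] Un_commute[of C A]
      Un_commute[of C B] Int_commute[of C D] not_le[symmetric] by blast
  \<comment> \<open>Where the orders are compatible with \<open>sums\<close>, the lower bounds on
    crossing numbers of opposite corners contradict \<open>x\<close>, in some cases only after both
    inequalities of \<open>x\<close> are added.\<close>
  show False
    using sums x A B C D by (elim disjE conjE) linarith+
qed

section \<open>Tangles\<close>

lemma induced_subgraph_cover:
  assumes "simple_graph G" "A1 \<union> A2 \<union> A3 = verts G"
    and "\<And>u v. {u, v} \<in> edges G \<Longrightarrow> u \<in> verts G \<Longrightarrow> v \<in> verts G \<Longrightarrow>
      {u, v} \<subseteq> A1 \<or> {u, v} \<subseteq> A2 \<or> {u, v} \<subseteq> A3"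
  shows "graph_union (graph_union (induced_subgraph G A1) (induced_subgraph G A2))
    (induced_subgraph G A3) = G"
proof -
  have "e \<subseteq> A1 \<or> e \<subseteq> A2 \<or> e \<subseteq> A3" if "e \<in> edges G" for e
    using that assms(1,3) unfolding simple_graph_def by metis
  moreover have "verts G \<inter> A1 \<union> verts G \<inter> A2 \<union> verts G \<inter> A3 = verts G"
    using assms(2) by blast
  ultimately show ?thesis
    unfolding graph_union_def induced_subgraph_def by (intro graph.equality) auto
qed

text \<open>The working form of the covering axiom: later contradictions come from showing that a
  separation puts every edge into one of the three sides.\<close>

lemma tangle_not_cover:
  assumes "simple_graph G" "tangle G k \<tau>"
    and "(A1, B1) \<in> \<tau>" "(A2, B2) \<in> \<tau>" "(A3, B3) \<in> \<tau>" "A1 \<union> A2 \<union> A3 = verts G"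
  shows "\<exists>u v. {u, v} \<in> edges G \<and> u \<in> verts G \<and> v \<in> verts G \<and>
    \<not> {u, v} \<subseteq> A1 \<and> \<not> {u, v} \<subseteq> A2 \<and> \<not> {u, v} \<subseteq> A3"
proof (rule ccontr)
  assume "\<not> ?thesis"
  then have "graph_union (graph_union (induced_subgraph G A1) (induced_subgraph G A2))
    (induced_subgraph G A3) = G"
    by (intro induced_subgraph_cover assms) blast
  then have "\<exists>(A1, B1)\<in>\<tau>. \<exists>(A2, B2)\<in>\<tau>. \<exists>(A3, B3)\<in>\<tau>.
      graph_union (graph_union (induced_subgraph G A1) (induced_subgraph G A2))
        (induced_subgraph G A3) = G"
    by (intro bexI[OF _ assms(3)] bexI[OF _ assms(4)] bexI[OF _ assms(5)] case_prodI)
  then show False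
    using assms(2) unfolding tangle_def by (elim conjE notE)
qed

lemma tangle_member:
  assumes "tangle G k \<tau>" "(A, B) \<in> \<tau>"
  shows tangle_separation: "oriented_separation G (A, B)" and tangle_order: "card (A \<inter> B) < k"
proof -
  have "\<forall>(A, B)\<in>\<tau>. oriented_separation G (A, B) \<and> card (A \<inter> B) < k"
    using assms(1) unfolding tangle_def by (elim conjE)
  with assms(2) show "oriented_separation G (A, B)" "card (A \<inter> B) < k"
    by auto
qed

lemma tangle_orients:
  assumes "tangle G k \<tau>" "oriented_separation G (A, B)" "card (A \<inter> B) < k"
  shows "(A, B) \<in> \<tau> \<or> (B, A) \<in> \<tau>"
proof -
  have "\<forall>A B. oriented_separation G (A, B) \<and> card (A \<inter> B) < k \<longrightarrow>
      (\<exists>!p. p \<in> {(A, B), (B, A)} \<and> p \<in> \<tau>)"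
    using assms(1) unfolding tangle_def by (elim conjE)
  with assms(2,3) show ?thesis
    by auto
qed

text \<open>Otherwise \<open>A\<close> is the whole vertex set, and repeating \<open>(A, B)\<close>
  three times covers the graph. This makes distinguishing separations proper.\<close>

lemma tangle_not_all:
  assumes "simple_graph G" "tangle G k \<tau>" "(A, B) \<in> \<tau>"
  shows "B - A \<noteq> {}"
proof
  assume "B - A = {}"
  then have "A = verts G"
    using tangle_separation[OF assms(2,3)] unfolding oriented_separation_def by auto
  then show False
    using tangle_not_cover[OF assms(1,2,3,3,3)] by auto
qed

text \<open>The order bound ensures that the tangle orients the corner. If it did so the other way,
  \<open>A\<close> and \<open>B \<union> D\<close> would cover the graph, since every edge lies in
  \<open>A\<close> or in \<open>B\<close>.\<close>

lemma tangle_corner: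
  assumes G: "simple_graph G" and \<tau>: "tangle G k \<tau>" and AB: "(A, B) \<in> \<tau>"
    and CD: "oriented_separation G (C, D)"
    and small: "card (A \<inter> C \<inter> (B \<union> D)) \<le> card (A \<inter> B)"
  shows "(A \<inter> C, B \<union> D) \<in> \<tau>"
proof (rule ccontr)
  assume "(A \<inter> C, B \<union> D) \<notin> \<tau>"
  moreover have sep: "oriented_separation G (A, B)"
    using tangle_separation[OF \<tau> AB] .
  moreover have "card (A \<inter> C \<inter> (B \<union> D)) < k"
    using small tangle_order[OF \<tau> AB] by (rule le_less_trans)
  ultimately have BD: "(B \<union> D, A \<inter> C) \<in> \<tau>"
    using tangle_orients[OF \<tau> oriented_separation_corner[OF sep CD]] by blast
  have "A \<union> A \<union> (B \<union> D) = verts G"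
    using sep CD unfolding oriented_separation_def by auto
  from tangle_not_cover[OF G \<tau> AB AB BD this]
  obtain u v where uv: "{u, v} \<in> edges G" "u \<in> verts G" "v \<in> verts G"
    "\<not> {u, v} \<subseteq> A" "\<not> {u, v} \<subseteq> B \<union> D"
    by (elim exE conjE)
  from oriented_separation_edge[OF sep uv(1-3)] uv(4,5) show False
    by auto
qed

section \<open>Separations that distinguish two tangles\<close>

lemma distinguishes_iff:
  "distinguishes {A, B} \<tau> \<tau>' \<longleftrightarrow>
     ((A, B) \<in> \<tau> \<and> (B, A) \<in> \<tau>') \<or> ((B, A) \<in> \<tau> \<and> (A, B) \<in> \<tau>')"
  unfolding distinguishes_def doubleton_eq_iff by blast

text \<open>A tangle containing \<open>(A, B)\<close> contains both corners on that side; if the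
  opposing tangle contained them too, they would cover the graph together with \<open>B\<close>. So
  one corner distinguishes the tangles, and the minimality of the order of \<open>{A, B}\<close>
  forces equal order and membership.\<close>

lemma efficient_distinguishers_entanglement:
  assumes G: "simple_graph G" and \<tau>: "tangle G k \<tau>" and \<tau>': "tangle G k' \<tau>'"
    and dist: "distinguishable G \<tau> \<tau>'"
  shows "entanglement G {s. efficiently_distinguishes G s \<tau> \<tau>'}" (is "entanglement G ?\<epsilon>")
  unfolding entanglement_def
proof (intro conjI allI impI ballI)
  let ?P = "\<lambda>s. separation G s \<and> distinguishes s \<tau> \<tau>'"
  obtain s where "?P s"
    using dist unfolding distinguishable_def by blast
  then have "?P (arg_min sep_order ?P) \<and> (\<forall>s'. ?P s' \<longrightarrow> sep_order (arg_min sep_order ?P) \<le> sep_order s')"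
    by (rule arg_min_nat_lemma)
  then show "?\<epsilon> \<noteq> {}"
    unfolding efficiently_distinguishes_def by blast
next
  fix s assume "s \<in> ?\<epsilon>"
  then obtain A B where s: "separation G s" "s = {A, B}" and "(A, B) \<in> \<tau>" "(B, A) \<in> \<tau>'"
    unfolding efficiently_distinguishes_def distinguishes_def by blast
  then have "A - B \<noteq> {}" "B - A \<noteq> {}"
    using tangle_not_all[OF G \<tau>] tangle_not_all[OF G \<tau>'] by simp_all
  with s show "proper_separation G s"
    unfolding proper_separation_def by (intro conjI exI)
next
  fix A B C D
  assume mem: "{A, B} \<in> ?\<epsilon>" and sepCD: "separation G {C, D}"
    and small: "sep_order {A \<inter> C, B \<union> D} \<le> sep_order {A, B}"
      "sep_order {A \<inter> D, B \<union> C} \<le> sep_order {A, B}"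
  have CD: "oriented_separation G (C, D)" "oriented_separation G (D, C)"
    using sepCD separation_iff oriented_separation_swap by blast+
  have sep: "oriented_separation G (A, B)"
    using mem separation_iff unfolding efficiently_distinguishes_def by blast
  have union: "A \<union> B = verts G" "C \<union> D = verts G"
    using sep CD unfolding oriented_separation_def by auto
  have small': "card (A \<inter> C \<inter> (B \<union> D)) \<le> card (A \<inter> B)" "card (A \<inter> D \<inter> (B \<union> C)) \<le> card (A \<inter> B)"
    using small by simp_all
  \<comment> \<open>Stated for arbitrary tangles because \<open>{A, B}\<close> may distinguish the
    two given ones in either direction.\<close>
  have side: "((A \<inter> C, B \<union> D) \<in> \<rho> \<and> (B \<union> D, A \<inter> C) \<in> \<rho>') \<or>
      ((A \<inter> D, B \<union> C) \<in> \<rho> \<and> (B \<union> C, A \<inter> D) \<in> \<rho>')"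
    if \<rho>: "tangle G l \<rho>" "(A, B) \<in> \<rho>" and \<rho>': "tangle G l' \<rho>'" "(B, A) \<in> \<rho>'" for l l' \<rho> \<rho>'
  proof (rule ccontr)
    assume contra: "\<not> ?thesis"
    have "(A \<inter> C, B \<union> D) \<in> \<rho>" "(A \<inter> D, B \<union> C) \<in> \<rho>"
      using tangle_corner[OF G \<rho>] CD small' by blast+
    moreover have "card (A \<inter> B) < l'"
      using tangle_order[OF \<rho>'] by (simp add: Int_commute)
    then have "(A \<inter> C, B \<union> D) \<in> \<rho>' \<or> (B \<union> D, A \<inter> C) \<in> \<rho>'"
      "(A \<inter> D, B \<union> C) \<in> \<rho>' \<or> (B \<union> C, A \<inter> D) \<in> \<rho>'"
      using tangle_orients[OF \<rho>'(1)] oriented_separation_corner[OF sep] CD small'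
      by (meson le_less_trans)+
    ultimately have corners: "(A \<inter> C, B \<union> D) \<in> \<rho>'" "(A \<inter> D, B \<union> C) \<in> \<rho>'"
      using contra by blast+
    have "B \<union> A \<inter> C \<union> A \<inter> D = verts G"
      using union by blast
    from tangle_not_cover[OF G \<rho>' corners this]
    obtain u v where uv: "{u, v} \<in> edges G" "u \<in> verts G" "v \<in> verts G"
      "\<not> {u, v} \<subseteq> B" "\<not> {u, v} \<subseteq> A \<inter> C" "\<not> {u, v} \<subseteq> A \<inter> D"
      by (elim exE conjE)
    \<comment> \<open>Each edge lies in \<open>B\<close>, or in \<open>A\<close> and moreover in
      \<open>C\<close> or \<open>D\<close>, so none escapes the triple.\<close>
    from oriented_separation_edge[OF sep uv(1-3)] oriented_separation_edge[OF CD(1) uv(1-3)] uv(4-6)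
    show False
      by auto
  qed
  have "distinguishes {A, B} \<tau> \<tau>'"
    using mem unfolding efficiently_distinguishes_def by simp
  then have "((A, B) \<in> \<tau> \<and> (B, A) \<in> \<tau>') \<or> ((B, A) \<in> \<tau> \<and> (A, B) \<in> \<tau>')"
    unfolding distinguishes_iff .
  then have dists: "distinguishes {A \<inter> C, B \<union> D} \<tau> \<tau>' \<or> distinguishes {A \<inter> D, B \<union> C} \<tau> \<tau>'"
  proof (elim disjE conjE)
    assume "(A, B) \<in> \<tau>" "(B, A) \<in> \<tau>'"
    from side[OF \<tau> this(1) \<tau>' this(2)] show ?thesis
      unfolding distinguishes_iff by blast
  next
    assume "(B, A) \<in> \<tau>" "(A, B) \<in> \<tau>'"
    from side[OF \<tau>' this(2) \<tau> this(1)] show ?thesis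
      unfolding distinguishes_iff by blast
  qed
  have eff: "sep_order c = sep_order {A, B} \<and> c \<in> ?\<epsilon>"
    if "distinguishes c \<tau> \<tau>'" "separation G c" "sep_order c \<le> sep_order {A, B}" for c
  proof -
    have min: "sep_order {A, B} \<le> sep_order s'" if "separation G s'" "distinguishes s' \<tau> \<tau>'" for s'
      using mem that unfolding efficiently_distinguishes_def by blast
    then have "sep_order c = sep_order {A, B}"
      using that by (simp add: le_antisym)
    then show ?thesis
      using that min unfolding efficiently_distinguishes_def by simp
  qed
  have corners: "separation G {A \<inter> C, B \<union> D}" "separation G {A \<inter> D, B \<union> C}"
    using oriented_separation_corner[OF sep] CD separation_iff by blast+
  from dists show "(sep_order {A \<inter> C, B \<union> D} = sep_order {A, B} \<and> {A \<inter> C, B \<union> D} \<in> ?\<epsilon>) \<or>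
      (sep_order {A \<inter> D, B \<union> C} = sep_order {A, B} \<and> {A \<inter> D, B \<union> C} \<in> ?\<epsilon>)"
  proof
    assume "distinguishes {A \<inter> C, B \<union> D} \<tau> \<tau>'"
    from eff[OF this corners(1) small(1)] show ?thesis ..
  next
    assume "distinguishes {A \<inter> D, B \<union> C} \<tau> \<tau>'"
    from eff[OF this corners(2) small(2)] show ?thesis ..
  qed
qed

text \<open>To find a friendly separation with a given property it thus suffices that the
  separations with this property form an entanglement.\<close>

lemma friendly_member:
  assumes "entanglement G \<epsilon>"
  shows "\<exists>s\<in>\<epsilon>. friendly G s"
proof -
  obtain s where "s \<in> \<epsilon>"
    using assms unfolding entanglement_def by blast
  then have "arg_min (crossing_number G) (\<lambda>s. s \<in> \<epsilon>) \<in> \<epsilon> \<and>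
    (\<forall>t. t \<in> \<epsilon> \<longrightarrow> crossing_number G (arg_min (crossing_number G) (\<lambda>s. s \<in> \<epsilon>)) \<le> crossing_number G t)"
    by (rule arg_min_nat_lemma)
  then show ?thesis
    using assms unfolding friendly_def by (meson not_less)
qed

section \<open>Adding a leaf to a tree\<close>

definition add_leaf :: "'t graph \<Rightarrow> 't \<Rightarrow> 't \<Rightarrow> 't graph" where
  "add_leaf T t l = \<lparr>verts = insert l (verts T), edges = insert {t, l} (edges T)\<rparr>"

lemma verts_add_leaf [simp]: "verts (add_leaf T t l) = insert l (verts T)"
  and edges_add_leaf [simp]: "edges (add_leaf T t l) = insert {t, l} (edges T)"
  by (simp_all add: add_leaf_def)

lemma simple_graph_edge: "simple_graph T \<Longrightarrow> {x, y} \<in> edges T \<Longrightarrow> x \<in> verts T \<and> y \<in> verts T"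
  unfolding simple_graph_def by (drule (1) bspec) (auto simp: doubleton_eq_iff)

lemma simple_graph_edge_subset: "simple_graph T \<Longrightarrow> e \<in> edges T \<Longrightarrow> e \<subseteq> verts T"
  unfolding simple_graph_def by (drule (1) bspec) auto

lemma sym_adjacency: "sym {(x, y). {x, y} \<in> E}"
  by (auto simp: sym_def insert_commute)

text \<open>The leaf is reached only through \<open>t\<close> and opens no new connection between
  old nodes. Simple graphs are considered instead of trees because an edge may have been deleted
  before.\<close>

lemma component_of_add_leaf:
  assumes T: "simple_graph T" and t: "t \<in> verts T" and l: "l \<notin> verts T" and a: "a \<in> verts T"
  shows "component_of (add_leaf T t l) a =
    (if t \<in> component_of T a then insert l (component_of T a) else component_of T a)"
proof -
  let ?R = "{(x, y). {x, y} \<in> edges T}\<^sup>*"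
  let ?R' = "{(x, y). {x, y} \<in> edges (add_leaf T t l)}\<^sup>*"
  \<comment> \<open>A walk enters and leaves \<open>l\<close> only through \<open>t\<close>, so
    arrival at \<open>l\<close> is recorded as arrival at \<open>t\<close> in the old graph.\<close>
  have fwd: "if w = l then (a, t) \<in> ?R else (a, w) \<in> ?R" if "(a, w) \<in> ?R'" for w
    using that
  proof induction
    case base
    then show ?case using a l by auto
  next
    case (step y z)
    from step(2) consider "{y, z} \<in> edges T" | "y = t" "z = l" | "y = l" "z = t"
      by (auto simp: doubleton_eq_iff)
    then show ?case
    proof cases
      case 1
      then have "y \<noteq> l" "z \<noteq> l"
        using simple_graph_edge[OF T] l by auto
      with 1 step(3) show ?thesis
        by (auto intro: rtrancl_into_rtrancl)
    qed (use step(3) t l in auto)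
  qed
  have "?R \<subseteq> ?R'"
    by (rule rtrancl_mono) auto
  moreover have "(a, l) \<in> ?R'" if "(a, t) \<in> ?R'"
    using that by (rule rtrancl_into_rtrancl) simp
  ultimately have "(a, w) \<in> ?R' \<longleftrightarrow> (if w = l then (a, t) \<in> ?R else (a, w) \<in> ?R)" for w
    using fwd[of w] fwd[of t] t l by (auto split: if_splits)
  then show ?thesis
    using t l unfolding component_of_def by auto
qed

lemma connected_graph_reach:
  assumes "t \<in> verts T" "component_of T t = verts T"
  shows "connected_graph T"
  unfolding connected_graph_def
proof (intro conjI ballI)
  show "verts T \<noteq> {}"
    using assms by blast
  fix v assume v: "v \<in> verts T"
  let ?R = "{(x, y). {x, y} \<in> edges T}\<^sup>*"
  have reach: "(t, w) \<in> ?R" if "w \<in> verts T" for w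
    using that assms unfolding component_of_def by blast
  have "(v, t) \<in> ?R"
    using reach[OF v] sym_rtrancl[OF sym_adjacency] by (rule symD[rotated])
  then show "component_of T v = verts T"
    using reach unfolding component_of_def by (auto intro: rtrancl_trans)
qed

lemma connected_add_leaf:
  assumes "simple_graph T" "connected_graph T" "t \<in> verts T" "l \<notin> verts T"
  shows "connected_graph (add_leaf T t l)"
proof (rule connected_graph_reach)
  have "component_of T t = verts T"
    using assms unfolding connected_graph_def by blast
  then show "component_of (add_leaf T t l) t = verts (add_leaf T t l)"
    using component_of_add_leaf[OF assms(1,3,4,3)] assms by simp
qed (use assms in simp)

lemma simple_add_leaf:
  assumes "simple_graph T" "t \<in> verts T" "l \<notin> verts T"
  shows "simple_graph (add_leaf T t l)"
  using assms unfolding simple_graph_def by (auto 4 4)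

text \<open>A cycle avoiding \<open>l\<close> would lie in \<open>T\<close>; one through
  \<open>l\<close> would have \<open>t\<close> on both sides of \<open>l\<close>, which is
  impossible with at least three distinct vertices.\<close>

lemma tree_add_leaf:
  assumes T: "is_tree T" and t: "t \<in> verts T" and l: "l \<notin> verts T"
  shows "is_tree (add_leaf T t l)"
proof -
  have simple: "simple_graph T" and conn: "connected_graph T" and acyc: "\<not> is_cycle T p" for p
    using T unfolding is_tree_def by blast+
  have "\<not> is_cycle (add_leaf T t l) p" for p
  proof
    assume cyc: "is_cycle (add_leaf T t l) p"
    let ?n = "length p"
    have n: "?n \<ge> 3" and dist: "distinct p"
      and edge: "\<And>i. i < ?n \<Longrightarrow> {p ! i, p ! (Suc i mod ?n)} \<in> insert {t, l} (edges T)"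
      using cyc unfolding is_cycle_def by auto
    have nbr: "y = t" if "{l, y} \<in> insert {t, l} (edges T)" for y
      using that simple_graph_edge[OF simple] l by (auto simp: doubleton_eq_iff)
    have "l \<in> set p"
    proof (rule ccontr)
      assume "l \<notin> set p"
      then have "{p ! i, p ! (Suc i mod ?n)} \<in> edges T" if "i < ?n" for i
      proof -
        have "Suc i mod ?n < ?n"
          using n by (intro mod_less_divisor) linarith
        then have "p ! i \<noteq> l" "p ! (Suc i mod ?n) \<noteq> l"
          using that \<open>l \<notin> set p\<close> nth_mem by metis+
        then show ?thesis
          using edge[OF that] by (auto simp: doubleton_eq_iff)
      qed
      then show False
        using acyc[of p] n dist unfolding is_cycle_def by blast
    qed
    then obtain i where i: "i < ?n" "p ! i = l"
      by (auto simp: in_set_conv_nth)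
    \<comment> \<open>The cyclic predecessor of \<open>i\<close>; position 0 has to wrap around
      explicitly.\<close>
    define j where "j = (if i = 0 then ?n - 1 else i - 1)"
    have j: "j < ?n" "Suc j mod ?n = i"
      using i n by (auto simp: j_def)
    have "p ! (Suc i mod ?n) = t"
      using edge[OF i(1)] i(2) nbr by simp
    moreover have "p ! j = t"
      using edge[OF j(1)] j(2) i(2) nbr by (simp add: insert_commute)
    moreover have "Suc i mod ?n < ?n"
      using n by (intro mod_less_divisor) linarith
    ultimately have "Suc i mod ?n = j"
      using dist j(1) by (metis nth_eq_iff_index_eq)
    \<comment> \<open>An index whose successor is also its predecessor forces length at most
      two.\<close>
    then show False
      using i n by (auto simp: j_def mod_Suc split: if_splits)
  qed
  then show ?thesis
    using simple_add_leaf[OF simple t l] connected_add_leaf[OF simple conn t l]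
    unfolding is_tree_def by blast
qed

lemma simple_induced_subgraph: "simple_graph T \<Longrightarrow> simple_graph (induced_subgraph T X)"
  unfolding simple_graph_def induced_subgraph_def by fastforce

lemma simple_delete_edge: "simple_graph T \<Longrightarrow> simple_graph (delete_edge T e)"
  unfolding simple_graph_def delete_edge_def by simp

lemma connected_singleton: "verts T = {v} \<Longrightarrow> connected_graph T"
  by (auto simp: connected_graph_def component_of_def)

section \<open>Tree-decompositions from nested sets of separations\<close>

text \<open>Refers to the standard partial order on oriented separations, in which a smaller first
  and a larger second side means smaller. Such a pair marks a place in the tree built from
  \<open>N\<close> where a leaf can be attached.\<close>

definition below_some_orientation :: "'v set \<Rightarrow> 'v set \<Rightarrow> 'v set set set \<Rightarrow> bool" where
  "below_some_orientation A B N \<longleftrightarrow>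
     (\<forall>C D. {C, D} \<in> N \<longrightarrow> (A \<subseteq> C \<and> D \<subseteq> B) \<or> (A \<subseteq> D \<and> C \<subseteq> B))"

text \<open>Nested separations have comparable orientations, and above a minimal oriented separation
  comparability can only go upwards.\<close>

lemma nested_minimal_side:
  fixes G :: "'v graph"
  assumes fin: "finite (verts G)" and N: "nested_separations G N" "finite N" "N \<noteq> {}"
  shows "\<exists>A B. {A, B} \<in> N \<and> below_some_orientation A B (N - {{A, B}})"
proof -
  \<comment> \<open>Strictly monotone for the partial order on pairs of subsets of
    \<open>verts G\<close>, so an orientation minimising it is minimal in that order.\<close>
  define \<mu> :: "'v set \<times> 'v set \<Rightarrow> nat" where "\<mu> = (\<lambda>(A, B). card A + card (verts G - B))"
  let ?P = "\<lambda>(A, B). {A, B} \<in> N"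
  obtain s where "s \<in> N"
    using N by blast
  then obtain A' B' where "{A', B'} \<in> N"
    using N unfolding nested_separations_def separation_def by metis
  then have "?P (A', B')"
    by simp
  then have "?P (arg_min \<mu> ?P) \<and> (\<forall>q. ?P q \<longrightarrow> \<mu> (arg_min \<mu> ?P) \<le> \<mu> q)"
    by (rule arg_min_nat_lemma)
  moreover obtain A B where "arg_min \<mu> ?P = (A, B)"
    by fastforce
  ultimately have AB: "{A, B} \<in> N" and min: "\<And>C D. {C, D} \<in> N \<Longrightarrow> \<mu> (A, B) \<le> \<mu> (C, D)"
    by auto
  have sub: "C \<subseteq> verts G" "D \<subseteq> verts G" if "{C, D} \<in> N" for C D
  proof -
    have "oriented_separation G (C, D)"
      using that N(1) separation_iff[of G C D] unfolding nested_separations_def by simp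
    then show "C \<subseteq> verts G" "D \<subseteq> verts G"
      unfolding oriented_separation_def by auto
  qed
  have eq: "C = A \<and> D = B" if CD: "{C, D} \<in> N" and "C \<subseteq> A" "B \<subseteq> D" for C D
  proof -
    have finA: "finite A" and finB: "finite (verts G - B)"
      using sub[OF AB] fin finite_subset by blast+
    have "verts G - D \<subseteq> verts G - B"
      using that by blast
    then have "card C \<le> card A" "card (verts G - D) \<le> card (verts G - B)"
      using that finA finB by (simp_all add: card_mono)
    then have "card C = card A" "card (verts G - D) = card (verts G - B)"
      using min[OF CD] unfolding \<mu>_def by auto
    then have "C = A" "verts G - D = verts G - B"
      using card_subset_eq finA finB that \<open>verts G - D \<subseteq> verts G - B\<close> by metis+
    then show ?thesis
      using sub[OF AB] sub[OF CD] by blast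
  qed
  have "(A \<subseteq> C \<and> D \<subseteq> B) \<or> (A \<subseteq> D \<and> C \<subseteq> B)" if CD: "{C, D} \<in> N - {{A, B}}" for C D
  proof -
    have "nested {A, B} {C, D}"
      using AB CD N unfolding nested_separations_def by blast
    moreover have CD': "{C, D} \<in> N" "{D, C} \<in> N" "{C, D} \<noteq> {A, B}" "{D, C} \<noteq> {A, B}"
      using CD insert_commute[of D C "{}"] by simp_all
    have "\<not> (C \<subseteq> A \<and> B \<subseteq> D)" "\<not> (D \<subseteq> A \<and> B \<subseteq> C)"
      using eq[OF CD'(1)] eq[OF CD'(2)] CD'(3,4) by auto
    ultimately show ?thesis
      unfolding nested_iff by simp
  qed
  with AB show ?thesis
    unfolding below_some_orientation_def by blast
qed

text \<open>
  The last conjunct strengthens the induction: it supplies the node to which the next leaf is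
  attached.
\<close>

lemma tree_decomposition_of_nested:
  assumes G: "finite_graph G" and "finite N" "nested_separations G N"
  shows "\<exists>(T :: nat graph) V. finite (verts T) \<and> tree_decomposition G T V \<and> gives_rise_to N T V \<and>
    (\<forall>A B. A \<subseteq> verts G \<longrightarrow> below_some_orientation A B N \<longrightarrow>
       (\<exists>t\<in>verts T. A \<subseteq> V t \<and> (\<forall>x\<in>verts T. x \<noteq> t \<longrightarrow> V x \<subseteq> B)))"
  using assms(2,3)
proof (induction "card N" arbitrary: N)
  case 0
  \<comment> \<open>A single node carrying all vertices serves every pair \<open>(A, B)\<close>, as
    there is no other part to constrain.\<close>
  let ?T = "\<lparr>verts = {0}, edges = {}\<rparr> :: nat graph" and ?V = "\<lambda>_. verts G"
  have "is_tree ?T"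
    using connected_singleton[of ?T 0]
    by (auto simp: is_tree_def is_cycle_def simple_graph_def intro!: exI[of _ 0])
  moreover have "connected_graph (induced_subgraph ?T {t. v \<in> ?V t})" if "v \<in> verts G" for v
    using that by (intro connected_singleton[of _ 0]) (simp add: induced_subgraph_def)
  ultimately have "tree_decomposition G ?T ?V"
    using G simple_graph_edge_subset[of G] unfolding tree_decomposition_def finite_graph_def by auto
  moreover have "N = {}"
    using 0 by simp
  then have "gives_rise_to N ?T ?V"
    unfolding gives_rise_to_def by (simp add: bij_betw_def)
  ultimately show ?case
    by (intro exI[of _ ?T] exI[of _ ?V]) simp
next
  case (Suc n)
  have fin: "finite (verts G)"
    using G unfolding finite_graph_def by simp
  obtain A B where AB: "{A, B} \<in> N" and below: "below_some_orientation A B (N - {{A, B}})"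
    using nested_minimal_side[OF fin Suc.prems(2,1)] Suc.hyps(2) by fastforce
  let ?N = "N - {{A, B}}"
  have IH: "n = card ?N" "finite ?N" "nested_separations G ?N"
    using Suc.hyps(2) Suc.prems AB unfolding nested_separations_def by auto
  from Suc.hyps(1)[OF IH] obtain T :: "nat graph" and V where finT: "finite (verts T)"
    and td: "tree_decomposition G T V" and rise: "gives_rise_to ?N T V"
    and node_all: "\<forall>A B. A \<subseteq> verts G \<longrightarrow> below_some_orientation A B ?N \<longrightarrow>
       (\<exists>t\<in>verts T. A \<subseteq> V t \<and> (\<forall>x\<in>verts T. x \<noteq> t \<longrightarrow> V x \<subseteq> B))"
    by (elim exE conjE)
  have node: "\<exists>t\<in>verts T. A \<subseteq> V t \<and> (\<forall>x\<in>verts T. x \<noteq> t \<longrightarrow> V x \<subseteq> B)"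
    if "A \<subseteq> verts G" "below_some_orientation A B ?N" for A B
    using node_all that by simp
  have sep: "oriented_separation G (A, B)"
    using AB Suc.prems separation_iff unfolding nested_separations_def by blast
  then have ABV: "A \<union> B = verts G"
    unfolding oriented_separation_def by simp
  then have "A \<subseteq> verts G"
    by blast
  \<comment> \<open>The strengthened hypothesis at \<open>(A, B)\<close> itself yields the node
    \<open>t\<close> for the new leaf; all other parts already lie in \<open>B\<close>.\<close>
  from node[OF this below] obtain t where t: "t \<in> verts T" "A \<subseteq> V t"
    and "\<forall>x\<in>verts T. x \<noteq> t \<longrightarrow> V x \<subseteq> B"
    by (elim bexE conjE)
  then have others: "V x \<subseteq> B" if "x \<in> verts T" "x \<noteq> t" for x
    using that by simp
  \<comment> \<open>Nodes are natural numbers, so a fresh one is always available.\<close>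
  obtain l where l: "l \<notin> verts T"
    using finT ex_new_if_finite by auto
  then have lt: "l \<noteq> t"
    using t by blast
  define T' where "T' = add_leaf T t l"
  \<comment> \<open>Only the part at \<open>t\<close> can stick out of \<open>B\<close>; after it is
    trimmed, all old parts lie in \<open>B\<close>.\<close>
  define V' where "V' = V(t := V t \<inter> B, l := A)"
  have V'l: "V' l = A" and V't: "V' t = V t \<inter> B"
    and V'x: "\<And>x. x \<in> verts T \<Longrightarrow> x \<noteq> t \<Longrightarrow> V' x = V x"
    using lt l unfolding V'_def by auto
  have V'B: "V' x \<subseteq> B" if "x \<in> verts T" for x
    using that others V't V'x by (cases "x = t") auto
  have tree: "is_tree T" and cover: "(\<Union>x\<in>verts T. V x) = verts G"
    and edge: "\<And>e. e \<in> edges G \<Longrightarrow> \<exists>x\<in>verts T. e \<subseteq> V x"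
    and conn: "\<And>v. v \<in> verts G \<Longrightarrow> connected_graph (induced_subgraph T {x. v \<in> V x})"
    using td unfolding tree_decomposition_def by blast+
  have simple: "simple_graph T" and connT: "connected_graph T"
    using tree unfolding is_tree_def by blast+
  have no_l: "l \<notin> e" if "e \<in> edges T" for e
    using simple_graph_edge_subset[OF simple that] l by blast
  have Vt: "V t \<subseteq> A \<union> B"
    using cover t ABV by blast
  have td': "tree_decomposition G T' V'"
    unfolding tree_decomposition_def
  proof (intro conjI ballI)
    show "is_tree T'"
      unfolding T'_def using tree t l by (intro tree_add_leaf)
    have union: "(\<Union>x\<in>verts T. V x) = A \<union> (\<Union>x\<in>verts T. V' x)"
    proof (rule set_eqI)
      fix v
      show "v \<in> (\<Union>x\<in>verts T. V x) \<longleftrightarrow> v \<in> A \<union> (\<Union>x\<in>verts T. V' x)"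
        using V't V'x Vt t by (auto; metis UnE IntI Int_iff subsetD)
    qed
    then show "(\<Union>x\<in>verts T'. V' x) = verts G"
      using cover V'l unfolding T'_def by simp
  next
    fix e assume e: "e \<in> edges G"
    then obtain x where x: "x \<in> verts T" "e \<subseteq> V x"
      using edge by blast
    obtain u v where uv: "e = {u, v}" "u \<in> verts G" "v \<in> verts G"
      using e G unfolding finite_graph_def simple_graph_def by blast
    then have "e \<subseteq> A \<or> e \<subseteq> B"
      using oriented_separation_edge[OF sep] e by blast
    then show "\<exists>x\<in>verts T'. e \<subseteq> V' x"
    proof
      assume "e \<subseteq> A"
      then show ?thesis
        unfolding T'_def by (intro bexI[of _ l]) (simp_all add: V'l)
    next
      assume "e \<subseteq> B"
      then have "e \<subseteq> V' x"
        using x V't V'x[of x] by (cases "x = t") auto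
      then show ?thesis
        using x(1) unfolding T'_def by (intro bexI[of _ x]) simp_all
    qed
  next
    fix v assume v: "v \<in> verts G"
    let ?H = "induced_subgraph T {x. v \<in> V x}" and ?H' = "induced_subgraph T' {x. v \<in> V' x}"
    have Vv: "v \<in> V' x \<longleftrightarrow> v \<in> V x" if "v \<in> B" "x \<in> verts T" for x
      using that V't V'x by (cases "x = t") auto
    \<comment> \<open>The nodes whose parts contain \<open>v\<close> are \<open>l\<close> alone if
      \<open>v\<close> is outside \<open>B\<close>, the old ones with \<open>l\<close> attached at
      \<open>t\<close> if \<open>v\<close> lies in both sides, and the old ones unchanged
      otherwise.\<close>
    show "connected_graph ?H'"
    proof (cases "v \<in> B")
      case False
      then have "verts ?H' = {l}"
        using V'l V'B v ABV unfolding T'_def induced_subgraph_def by auto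
      then show ?thesis
        by (rule connected_singleton)
    next
      case vB: True
      have sub: "e \<subseteq> {x. v \<in> V' x} \<longleftrightarrow> e \<subseteq> {x. v \<in> V x}" if "e \<in> edges T" for e
        using simple_graph_edge_subset[OF simple that] Vv[OF vB] by blast
      show ?thesis
      proof (cases "v \<in> A")
        case True
        have "?H' = add_leaf ?H t l"
          using True vB Vv[OF vB] V'l t sub
          unfolding T'_def induced_subgraph_def add_leaf_def by auto
        moreover have "t \<in> verts ?H" "l \<notin> verts ?H"
          using True t l unfolding induced_subgraph_def by auto
        ultimately show ?thesis
          using connected_add_leaf[OF simple_induced_subgraph[OF simple] conn[OF v]] by simp
      next
        case False
        then have "?H' = ?H"
          using Vv[OF vB] V'l sub
          unfolding T'_def induced_subgraph_def add_leaf_def by auto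
        then show ?thesis
          using conn[OF v] by simp
      qed
    qed
  qed
  \<comment> \<open>Only the component containing \<open>t\<close> gains the leaf, and what was
    trimmed at \<open>t\<close> comes back with it:
    \<open>A \<union> (V t \<inter> B) = V t\<close>, as
    \<open>A \<subseteq> V t \<subseteq> A \<union> B\<close>.\<close>
  have old: "induced_separation T' V' e = induced_separation T V e" if e: "e \<in> edges T" for e
  proof -
    let ?D = "delete_edge T e"
    have D': "delete_edge T' e = add_leaf ?D t l"
      using e no_l unfolding T'_def delete_edge_def add_leaf_def by auto
    have "(\<Union>x\<in>component_of (delete_edge T' e) a. V' x) = (\<Union>x\<in>component_of ?D a. V x)" if a: "a \<in> e" for a
    proof -
      let ?C = "component_of ?D a"
      have "component_of (delete_edge T' e) a = (if t \<in> ?C then insert l ?C else ?C)"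
        unfolding D' using simple_graph_edge_subset[OF simple e] a t l
        by (intro component_of_add_leaf simple_delete_edge simple) (auto simp: delete_edge_def)
      moreover have C: "?C \<subseteq> verts T"
        by (auto simp: component_of_def delete_edge_def)
      moreover have "(\<Union>x\<in>insert l ?C. V' x) = (\<Union>x\<in>?C. V x)" if "t \<in> ?C"
      proof -
        have "?C = insert t (?C - {t})"
          using that by blast
        then have "(\<Union>x\<in>insert l ?C. V' x) = A \<union> (V t \<inter> B) \<union> (\<Union>x\<in>?C - {t}. V' x)"
          using V'l V't by blast
        also have "\<dots> = V t \<union> (\<Union>x\<in>?C - {t}. V x)"
          using V'x C Vt t by fastforce
        also have "\<dots> = (\<Union>x\<in>?C. V x)"
          using that by blast
        finally show ?thesis .
      qed
      moreover have "(\<Union>x\<in>?C. V' x) = (\<Union>x\<in>?C. V x)" if "t \<notin> ?C"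
        using that C V'x by (intro SUP_cong) auto
      ultimately show ?thesis
        by simp
    qed
    then show ?thesis
      unfolding induced_separation_def by (intro image_cong refl)
  qed
  \<comment> \<open>Deleting the new edge isolates \<open>l\<close>, whose part is \<open>A\<close>;
    the old parts after trimming have union \<open>B\<close>.\<close>
  have new: "induced_separation T' V' {t, l} = {A, B}"
  proof -
    let ?D = "delete_edge T' {t, l}"
    have D: "verts ?D = insert l (verts T)" "edges ?D = edges T"
      using no_l unfolding T'_def delete_edge_def by auto
    have "w = l" if "(l, w) \<in> {(x, y). {x, y} \<in> edges T}\<^sup>*" for w
      using that by induction (use no_l in auto)
    then have "component_of ?D l = {l}"
      unfolding component_of_def D by auto
    moreover have "component_of ?D t = verts T"
    proof -
      have "component_of T t = verts T"
        using connT t unfolding connected_graph_def by blast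
      moreover have "w \<noteq> l" if "(t, w) \<in> {(x, y). {x, y} \<in> edges T}\<^sup>*" for w
        using that by induction (use lt no_l in auto)
      ultimately show ?thesis
        unfolding component_of_def D by auto
    qed
    moreover have "(\<Union>x\<in>verts T. V' x) = B"
    proof
      show "(\<Union>x\<in>verts T. V' x) \<subseteq> B"
        using V'B by blast
      show "B \<subseteq> (\<Union>x\<in>verts T. V' x)"
      proof
        fix v assume v: "v \<in> B"
        then obtain x where "x \<in> verts T" "v \<in> V x"
          using cover ABV by blast
        then show "v \<in> (\<Union>x\<in>verts T. V' x)"
          using v V't V'x by (cases "x = t") auto
      qed
    qed
    ultimately show ?thesis
      unfolding induced_separation_def using V'l by auto
  qed
  \<comment> \<open>The old edges correspond to \<open>?N\<close>, from which \<open>{A, B}\<close>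
    was removed, so the new edge extends the bijection without collision.\<close>
  have rise': "gives_rise_to N T' V'"
  proof -
    have "bij_betw (induced_separation T' V') (edges T) ?N"
      using rise old unfolding gives_rise_to_def by (simp cong: bij_betw_cong)
    then have "bij_betw (induced_separation T' V') (insert {t, l} (edges T)) (insert {A, B} ?N)"
      using no_l by (subst new[symmetric], intro notIn_Un_bij_betw[of "{t, l}", simplified])
        (auto simp: new)
    then show ?thesis
      using AB unfolding gives_rise_to_def T'_def by (simp add: insert_absorb)
  qed
  have node': "\<exists>x\<in>verts T'. A' \<subseteq> V' x \<and> (\<forall>y\<in>verts T'. y \<noteq> x \<longrightarrow> V' y \<subseteq> B')"
    if A': "A' \<subseteq> verts G" "below_some_orientation A' B' N" for A' B'
  proof -
    \<comment> \<open>Below \<open>(A, B)\<close>, the leaf \<open>l\<close> serves. Below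
      \<open>(B, A)\<close>, the old node serves, since \<open>A' \<subseteq> B\<close> survives the
      trimming and the part at \<open>l\<close> is \<open>A \<subseteq> B'\<close>.\<close>
    have "(A' \<subseteq> A \<and> B \<subseteq> B') \<or> (A' \<subseteq> B \<and> A \<subseteq> B')"
      using A' AB unfolding below_some_orientation_def by blast
    then show ?thesis
    proof
      assume "A' \<subseteq> A \<and> B \<subseteq> B'"
      then show ?thesis
        using V'l V'B unfolding T'_def by auto
    next
      assume *: "A' \<subseteq> B \<and> A \<subseteq> B'"
      have "below_some_orientation A' B' ?N"
        using A'(2) unfolding below_some_orientation_def by simp
      from node[OF A'(1) this] obtain x where x: "x \<in> verts T" "A' \<subseteq> V x"
        and y: "\<forall>y\<in>verts T. y \<noteq> x \<longrightarrow> V y \<subseteq> B'"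
        by (elim bexE conjE)
      have "A' \<subseteq> V' x"
        using x * V't V'x by (cases "x = t") auto
      moreover have "V' y \<subseteq> B'" if "y \<in> verts T" "y \<noteq> x" for y
        using y that V't V'x by (cases "y = t") auto
      ultimately show ?thesis
        using x(1) * V'l unfolding T'_def by (intro bexI[of _ x]) auto
    qed
  qed
  have "finite (verts T')"
    using finT unfolding T'_def by simp
  then show ?case
    by (intro exI[of _ T'] exI[of _ V'] conjI allI impI td' rise' node')
qed

section \<open>The tree-decomposition given by the friendly separations\<close>

theorem theorem1:
  fixes G :: "'v graph"
  assumes "finite_graph G"
  shows "nested_separations G (friendly_separations G) \<and>
    (\<exists>(T :: nat graph) V. tree_decomposition G T V \<and>
       gives_rise_to (friendly_separations G) T V \<and>
       (\<forall>k k' \<tau> \<tau>'. tangle G k \<tau> \<longrightarrow> tangle G k' \<tau>' \<longrightarrow> distinguishable G \<tau> \<tau>' \<longrightarrow>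
          td_efficiently_distinguishes G T V \<tau> \<tau>'))"
proof -
  have simple: "simple_graph G" and fin: "finite (verts G)"
    using assms unfolding finite_graph_def by blast+
  have sep: "friendly_separations G \<subseteq> {s. separation G s}"
    using entanglement_separation unfolding friendly_separations_def friendly_def by blast
  then have nested: "nested_separations G (friendly_separations G)"
    using friendly_nested[OF fin] unfolding nested_separations_def friendly_separations_def
    by (intro conjI ballI) auto
  have "finite (friendly_separations G)"
    using sep finite_separations[OF fin] finite_subset by blast
  from tree_decomposition_of_nested[OF assms this nested]
  obtain T :: "nat graph" and V where td: "tree_decomposition G T V"
    and rise: "gives_rise_to (friendly_separations G) T V"
    by (elim exE conjE)
  have "td_efficiently_distinguishes G T V \<tau> \<tau>'"
    if tangles: "tangle G k \<tau>" "tangle G k' \<tau>'" "distinguishable G \<tau> \<tau>'" for k k' \<tau> \<tau>'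
  proof -
    \<comment> \<open>A friendly member of the entanglement of efficient distinguishers; like every
      friendly separation it is induced by an edge.\<close>
    obtain s where s: "friendly G s" "efficiently_distinguishes G s \<tau> \<tau>'"
      using friendly_member[OF efficient_distinguishers_entanglement[OF simple tangles]] by auto
    have "s \<in> induced_separation T V ` edges T"
      using rise s(1) unfolding gives_rise_to_def bij_betw_def friendly_separations_def by simp
    then obtain e where "e \<in> edges T" "s = induced_separation T V e"
      by (elim imageE)
    with s(2) show ?thesis
      unfolding td_efficiently_distinguishes_def by (intro bexI[of _ e]) simp_all
  qed
  then show ?thesis
    by (intro conjI exI[of _ T] exI[of _ V] allI impI nested td rise)
qed

end
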